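(* Let $n,d\in\mathbb{N}$ and consider a robotic network of $n$ agents with positions in $\mathbb{R}^d$, initial positions $p^{[1]}(0),\dots,p^{[n]}(0)$, and some communication edge map $E_{\mathrm{cmm}}$. Suppose that the agents run the FloodMEB algorithm (defined in the context) under any control and communication law such that the communication graph remains connected along the evolution, i.e., the graph on $\{1,\dots,n\}$ with edge set $E_{\mathrm{cmm}}(p^{[1]}(t),\dots,p^{[n]}(t))$ is connected at every time $t\in\mathbb{N}_0$. Then the FloodMEB algorithm achieves consensus on the minimal enclosing ball of the initial positions: there exists $T\in\mathbb{N}$ such that for all $t\ge T$ and all $i\in\{1,\dots,n\}$, $$\operatorname{MEB}\big(P^{[i]}_{\mathrm{bndry}}(t)\big)=\operatorname{MEB}\big(\{p^{[1]}(0),\dots,p^{[n]}(0)\}\big).$$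
   Context: $\mathbb{N}_0$ is the set of non-negative integers. A communication edge map $E_{\mathrm{cmm}}$ assigns to each configuration $(p^{[1]},\dots,p^{[n]})\in(\mathbb{R}^d)^n$ a set of edges on $\{1,\dots,n\}$; the resulting communication graphs are undirected. At time $t$, $\mathcal{N}(i)$ denotes the set of neighbors of $i$ in the graph with edge set $E_{\mathrm{cmm}}(p^{[1]}(t),\dots,p^{[n]}(t))$, and agent $i$ receives the messages of exactly the agents in $\mathcal{N}(i)$. The positions evolve in discrete time according to some control law (arbitrary apart from the stated connectivity requirement). For a finite nonempty set $Q\subset\mathbb{R}^d$, $\operatorname{MEB}(Q)$ is the minimal enclosing ball of $Q$ (the unique closed Euclidean ball of smallest radius containing $Q$), and $\operatorname{MEB}_{\mathrm{bndry}}(Q)$ is a subset of $Q$ of minimum cardinality, lying on the boundary of $\operatorname{MEB}(Q)$, that identifies this ball, i.e., whose minimal enclosing ball equals $\operatorname{MEB}(Q)$ (if several such sets exist, any one of them is selected). FloodMEB algorithm. Each agent $i$ maintains the logic state $w^{[i]}=(P^{[i]}_{\mathrm{bndry}},p^{[i]}_0)$, where $P^{[i]}_{\mathrm{bndry}}$ is a finite set of points and $p_0^{[i]}$ is a point, initialized as $P^{[i]}_{\mathrm{bndry}}(0)=\{p^{[i]}(0)\}$ and $p^{[i]}_0=p^{[i]}(0)$. At each time $t\in\mathbb{N}_0$ every agent sends $w^{[i]}(t)$ to its neighbors, acquires $w^{[j]}(t)$ for $j\in\mathcal{N}(i)$, and updates $$P^{[i]}_{\mathrm{bndry}}(t+1)=\operatorname{MEB}_{\mathrm{bndry}}\Big(\bigcup_{j\in\mathcal{N}(i)\cup\{i\}}\big(P^{[j]}_{\mathrm{bndry}}(t)\cup\{p_0^{[j]}\}\big)\Big),$$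 while $p_0^{[i]}$ is kept unchanged. *)

theory Defs
  imports "HOL-Analysis.Analysis"
begin

definition is_min_enclosing_ball :: "'a::euclidean_space set \<Rightarrow> 'a set \<Rightarrow> bool" where
  "is_min_enclosing_ball Q B \<longleftrightarrow>
     (\<exists>c r. B = cball c r \<and> Q \<subseteq> cball c r \<and> (\<forall>c' r'. Q \<subseteq> cball c' r' \<longrightarrow> r \<le> r'))"

text \<open>Meaningful for finite nonempty \<open>Q\<close> only; in particular \<open>MEB {}\<close> is an unspecified set.\<close>

definition MEB :: "'a::euclidean_space set \<Rightarrow> 'a set" where
  "MEB Q = (THE B. is_min_enclosing_ball Q B)"

text \<open>The selection of a minimal boundary set need not be unique, so it is rendered as a relation:
  \<open>S\<close> is an admissible value of the boundary operator at \<open>Q\<close>. The condition \<open>S \<noteq> {}\<close> is needed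
  because \<open>MEB {}\<close> is unspecified.\<close>

definition is_MEB_bndry :: "'a::euclidean_space set \<Rightarrow> 'a set \<Rightarrow> bool" where
  "is_MEB_bndry Q S \<longleftrightarrow>
     is_arg_min card (\<lambda>S. S \<noteq> {} \<and> S \<subseteq> Q \<and> S \<subseteq> frontier (MEB Q) \<and> MEB S = MEB Q) S"

text \<open>The agents are the elements of a finite type \<open>'n\<close>, and an undirected graph on them is given by
  a symmetric set of ordered pairs.\<close>

definition neighbors :: "('n \<times> 'n) set \<Rightarrow> 'n \<Rightarrow> 'n set" where
  "neighbors E i = {j. (i, j) \<in> E}"

definition connected_graph :: "('n \<times> 'n) set \<Rightarrow> bool" where
  "connected_graph E \<longleftrightarrow> (\<forall>i j. (i, j) \<in> E\<^sup>*)"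

text \<open>\<open>p t $ i\<close> is the position of agent \<open>i\<close> at time \<open>t\<close>, and \<open>w t i\<close> is its logic state, a pair of
  a boundary point set and a stored initial position. The trajectory \<open>p\<close> is arbitrary, so every
  control law is covered. Each agent may resolve the choice of a boundary set anew at each time.\<close>

definition FloodMEB_run ::
  "((real^'d)^'n \<Rightarrow> ('n::finite \<times> 'n) set) \<Rightarrow> (nat \<Rightarrow> (real^'d::finite)^'n) \<Rightarrow>
   (nat \<Rightarrow> 'n \<Rightarrow> (real^'d) set \<times> (real^'d)) \<Rightarrow> bool" where
  "FloodMEB_run E\<^sub>c\<^sub>m\<^sub>m p w \<longleftrightarrow>
     (\<forall>i. w 0 i = ({p 0 $ i}, p 0 $ i)) \<and>
     (\<forall>t i. is_MEB_bndry
              (\<Union>j \<in> neighbors (E\<^sub>c\<^sub>m\<^sub>m (p t)) i \<union> {i}. fst (w t j) \<union> {snd (w t j)})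
              (fst (w (Suc t) i)) \<and>
            snd (w (Suc t) i) = snd (w t i))"

end

(* The radius of the minimal enclosing ball of an agent's boundary set never decreases, and it never
   falls below the previous radius of any neighbor. Since boundary sets only contain initial
   positions, the radii take finitely many values and become constant; connectivity then makes them
   equal. A bounded set is contained in only one ball of its minimal radius, so equality of radii
   forces neighbors to hold the same ball. That common ball contains every stored initial position
   and is no larger than the ball sought, so uniqueness applies once more. *)
theory Submission
  imports Defs
begin

text \<open>An infimum makes radii comparable before a minimal ball is known to exist or to be
  unique.\<close>

definition MEB_radius :: "'a::euclidean_space set \<Rightarrow> real" where
  "MEB_radius Q = Inf {r. \<exists>c. Q \<subseteq> cball c r}"

text \<open>Nonemptiness rules out negative radii, whose balls are empty, so 0 bounds the enclosing
  radii from below.\<close>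

lemma MEB_radius_le:
  assumes "Q \<noteq> {}" and "Q \<subseteq> cball c r"
  shows "MEB_radius Q \<le> r"
  unfolding MEB_radius_def
proof (rule cInf_lower)
  show "bdd_below {r. \<exists>c. Q \<subseteq> cball c r}"
  proof (rule bdd_belowI)
    fix s assume "s \<in> {r. \<exists>c. Q \<subseteq> cball c r}"
    then obtain c where "Q \<subseteq> cball c s" by auto
    then have "cball c s \<noteq> {}" using \<open>Q \<noteq> {}\<close> by auto
    then show "0 \<le> s" by simp
  qed
qed (use assms in auto)

text \<open>The infimum is attained by compactness: only a compact set of pairs (centre, radius) has
  to be searched.\<close>

lemma subset_cball_MEB_radius:
  fixes Q :: "'a::euclidean_space set"
  assumes "Q \<noteq> {}" and "bounded Q"
  obtains c where "Q \<subseteq> cball c (MEB_radius Q)"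
proof -
  obtain c0 r0 where r0: "Q \<subseteq> cball c0 r0"
    using \<open>bounded Q\<close> bounded_subset_cball by blast
  obtain q where q: "q \<in> Q" using \<open>Q \<noteq> {}\<close> by blast
  \<comment> \<open>An enclosing ball of radius at most \<open>r0\<close> contains \<open>q\<close>,
    so its centre lies within \<open>r0\<close> of \<open>q\<close>. Hence \<open>K\<close> holds
    every candidate no larger than the initial ball.\<close>
  define K where "K = (\<Inter>x\<in>Q. {y. dist (fst y) x \<le> snd y}) \<inter> (cball q r0 \<times> {0..r0})"
  have "closed (\<Inter>x\<in>Q. {y::'a \<times> real. dist (fst y) x \<le> snd y})"
    by (intro closed_INT ballI closed_Collect_le continuous_intros)
  then have "compact K"
    unfolding K_def by (intro closed_Int_compact compact_Times) auto
  moreover have "dist c0 q \<le> r0" using r0 q by auto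
  then have "0 \<le> r0" by (rule order_trans[OF zero_le_dist])
  then have "(c0, r0) \<in> K"
    using r0 q by (auto simp: K_def dist_commute)
  ultimately obtain y where y: "y \<in> K" "\<And>z. z \<in> K \<Longrightarrow> snd y \<le> snd z"
    using continuous_attains_inf[of K snd] continuous_on_snd[OF continuous_on_id] by blast
  have sub: "Q \<subseteq> cball (fst y) (snd y)"
    using y(1) by (auto simp: K_def)
  have "snd y \<le> s" if "Q \<subseteq> cball c s" for c s
  proof (cases "s \<le> r0")
    case True
    have "dist c q \<le> s" using that q by auto
    then have "0 \<le> s" by (rule order_trans[OF zero_le_dist])
    moreover have "dist q c \<le> r0" using \<open>dist c q \<le> s\<close> True by (simp add: dist_commute)
    ultimately have "(c, s) \<in> K"
      using that True by (auto simp: K_def dist_commute)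
    then show ?thesis using y(2) by force
  next
    case False
    then show ?thesis using y(1) by (auto simp: K_def)
  qed
  then have "MEB_radius Q = snd y"
    unfolding MEB_radius_def using sub by (intro cInf_eq_minimum) auto
  with sub that show thesis by metis
qed

text \<open>Parallelogram law for \<open>c - q\<close> and \<open>c' - q\<close>: half their sum is
  \<open>midpoint c c' - q\<close>, and their difference is \<open>c - c'\<close>.\<close>

lemma dist_midpoint_le:
  fixes q c c' :: "'a::euclidean_space"
  assumes "dist c q \<le> r" and "dist c' q \<le> r"
  shows "dist (midpoint c c') q \<le> sqrt (r\<^sup>2 - (dist c c')\<^sup>2 / 4)"
proof -
  define u v where "u = c - q" and "v = c' - q"
  have "(norm u)\<^sup>2 \<le> r\<^sup>2" "(norm v)\<^sup>2 \<le> r\<^sup>2"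
    using assms by (auto simp: u_def v_def dist_norm intro: power_mono)
  moreover have "midpoint c c' - q = (1/2) *\<^sub>R (u + v)"
    by (simp add: midpoint_def u_def v_def algebra_simps flip: scaleR_2)
  then have "(dist (midpoint c c') q)\<^sup>2 = (norm (u + v))\<^sup>2 / 4"
    by (simp add: dist_norm power_divide)
  moreover have "dist c c' = norm (u - v)"
    by (simp add: u_def v_def dist_norm)
  moreover have "(norm (u + v))\<^sup>2 + (norm (u - v))\<^sup>2 = 2 * (norm u)\<^sup>2 + 2 * (norm v)\<^sup>2"
    by (simp add: power2_norm_eq_inner algebra_simps inner_commute)
  ultimately have "(dist (midpoint c c') q)\<^sup>2 \<le> r\<^sup>2 - (dist c c')\<^sup>2 / 4"
    by simp
  then show ?thesis by (rule real_le_rsqrt)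
qed

text \<open>If the centres were distinct, a ball around their midpoint would enclose
  \<open>Q\<close> with a radius below the infimum.\<close>

lemma MEB_center_unique:
  assumes "Q \<noteq> {}"
    and "Q \<subseteq> cball c (MEB_radius Q)" and "Q \<subseteq> cball c' (MEB_radius Q)"
  shows "c = c'"
proof -
  let ?r = "MEB_radius Q"
  obtain q where "q \<in> Q" using \<open>Q \<noteq> {}\<close> by blast
  with assms(2) have "dist c q \<le> ?r" by auto
  then have r: "0 \<le> ?r" using zero_le_dist[of c q] by linarith
  have "Q \<subseteq> cball (midpoint c c') (sqrt (?r\<^sup>2 - (dist c c')\<^sup>2 / 4))"
    using assms(2,3) dist_midpoint_le[of c _ ?r c'] by (auto simp: subset_iff)
  then have "?r \<le> sqrt (?r\<^sup>2 - (dist c c')\<^sup>2 / 4)"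
    by (rule MEB_radius_le[OF \<open>Q \<noteq> {}\<close>])
  then have "?r\<^sup>2 \<le> ?r\<^sup>2 - (dist c c')\<^sup>2 / 4"
    using r by (simp add: real_le_rsqrt real_sqrt_ge_0_iff sqrt_ge_absD)
  then show ?thesis by simp
qed

text \<open>Comparing two minimal balls both ways fixes the radius, and then the centre is unique;
  this resolves the \<open>THE\<close> in \<open>MEB\<close>.\<close>

lemma MEB_eqI:
  assumes "Q \<noteq> {}" and "Q \<subseteq> cball c (MEB_radius Q)"
  shows "MEB Q = cball c (MEB_radius Q)"
  unfolding MEB_def
proof (rule the_equality)
  show "is_min_enclosing_ball Q (cball c (MEB_radius Q))"
    unfolding is_min_enclosing_ball_def using assms MEB_radius_le by blast
next
  fix B assume "is_min_enclosing_ball Q B"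
  then obtain c' r where B: "B = cball c' r" "Q \<subseteq> cball c' r"
    and min: "\<And>c r'. Q \<subseteq> cball c r' \<Longrightarrow> r \<le> r'"
    unfolding is_min_enclosing_ball_def by blast
  have "r = MEB_radius Q"
    using min[OF assms(2)] MEB_radius_le[OF assms(1) B(2)] by simp
  then show "B = cball c (MEB_radius Q)"
    using B MEB_center_unique[OF assms] by simp
qed

lemma MEB_cball:
  assumes "Q \<noteq> {}" and "bounded Q"
  obtains c where "MEB Q = cball c (MEB_radius Q)" and "Q \<subseteq> cball c (MEB_radius Q)"
  using assms subset_cball_MEB_radius MEB_eqI by metis

lemma subset_MEB: "Q \<noteq> {} \<Longrightarrow> bounded Q \<Longrightarrow> Q \<subseteq> MEB Q"
  by (metis MEB_cball)

lemma MEB_radius_le_if_subset_MEB: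
  assumes "Q \<noteq> {}" "S \<noteq> {}" "bounded S" and "Q \<subseteq> MEB S"
  shows "MEB_radius Q \<le> MEB_radius S"
  by (metis MEB_cball MEB_radius_le assms)

text \<open>The ball \<open>MEB S\<close> encloses \<open>Q\<close>, and \<open>le\<close> makes its
  radius the least possible for \<open>Q\<close>; uniqueness of the minimal ball does the
  rest.\<close>

lemma MEB_eq_if_subset_MEB:
  assumes "Q \<noteq> {}" "S \<noteq> {}" "bounded S"
    and sub: "Q \<subseteq> MEB S" and le: "MEB_radius S \<le> MEB_radius Q"
  shows "MEB Q = MEB S"
proof -
  obtain c where c: "MEB S = cball c (MEB_radius S)"
    using assms MEB_cball by metis
  have "MEB_radius Q = MEB_radius S"
    using MEB_radius_le_if_subset_MEB[OF assms(1-4)] le by simp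
  then show ?thesis using MEB_eqI[OF \<open>Q \<noteq> {}\<close>, of c] sub c by simp
qed

lemma incseq_finite_range_eventually_const:
  fixes f :: "nat \<Rightarrow> real"
  assumes "incseq f" and "finite (range f)"
  shows "\<forall>\<^sub>F t in sequentially. f t = Max (range f)"
proof -
  have "Max (range f) \<in> range f" using assms(2) by (intro Max_in) auto
  then obtain T where T: "f T = Max (range f)" by auto
  have "f t = Max (range f)" if "t \<ge> T" for t
  proof (rule antisym)
    show "f t \<le> Max (range f)" using assms(2) by simp
    show "Max (range f) \<le> f t" using T incseqD[OF assms(1) that] by simp
  qed
  then show ?thesis by (auto simp: eventually_sequentially)
qed

text \<open>Paths lead from \<open>i\<close> to \<open>j\<close> and back, and \<open>g\<close>
  cannot increase along either.\<close>

lemma connected_graph_mono_imp_const: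
  assumes "connected_graph E" and step: "\<And>i j. (i, j) \<in> E \<Longrightarrow> g j \<le> (g i :: 'b::order)"
  shows "g i = g j"
proof -
  have le: "g b \<le> g a" for a b
  proof -
    have "(a, b) \<in> E\<^sup>*" using assms(1) by (simp add: connected_graph_def)
    then show ?thesis by induction (use step order_trans in blast)+
  qed
  show ?thesis by (intro antisym le)
qed

theorem mainTheorem1:
  fixes E\<^sub>c\<^sub>m\<^sub>m :: "(real^'d::finite)^'n::finite \<Rightarrow> ('n \<times> 'n) set"
    and p :: "nat \<Rightarrow> (real^'d)^'n"
    and w :: "nat \<Rightarrow> 'n \<Rightarrow> (real^'d) set \<times> (real^'d)"
  assumes undirected: "\<And>x. sym (E\<^sub>c\<^sub>m\<^sub>m x)"
    and run: "FloodMEB_run E\<^sub>c\<^sub>m\<^sub>m p w"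
    and connectivity: "\<And>t. connected_graph (E\<^sub>c\<^sub>m\<^sub>m (p t))"
  shows "\<exists>T. \<forall>t\<ge>T. \<forall>i. MEB (fst (w t i)) = MEB (range (\<lambda>j. p 0 $ j))"
proof -
  define X where "X = range (\<lambda>j. p 0 $ j)"
  define N where "N t i = neighbors (E\<^sub>c\<^sub>m\<^sub>m (p t)) i \<union> {i}" for t i
  define P where "P t i = fst (w t i)" for t i
  \<comment> \<open>The input of the update, with the stored point already replaced by its constant
    value; \<open>snd_w\<close> justifies this.\<close>
  define Q where "Q t i = (\<Union>j \<in> N t i. P t j \<union> {p 0 $ j})" for t i
  define \<rho> where "\<rho> t i = MEB_radius (P t i)" for t i
  have snd_w: "snd (w t i) = p 0 $ i" for t i
    using run by (induction t) (auto simp: FloodMEB_run_def)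
  have "is_MEB_bndry (Q t i) (P (Suc t) i)" for t i
    using run by (simp add: FloodMEB_run_def Q_def P_def N_def snd_w)
  then have bndry: "P (Suc t) i \<noteq> {}" "P (Suc t) i \<subseteq> Q t i"
    and MEB_P: "MEB (P (Suc t) i) = MEB (Q t i)" for t i
    by (auto simp: is_MEB_bndry_def is_arg_min_def)
  have P0: "P 0 i = {p 0 $ i}" for i
    using run by (simp add: FloodMEB_run_def P_def)
  have P_ne: "P t i \<noteq> {}" for t i
    by (cases t) (auto simp: P0 bndry)
  have P_X: "P t i \<subseteq> X" for t i
  proof (induction t arbitrary: i)
    case 0
    then show ?case by (auto simp: P0 X_def)
  next
    case (Suc t)
    have "Q t i \<subseteq> X" using Suc by (auto simp: Q_def X_def)
    then show ?case using bndry(2) by blast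
  qed
  have Q_X: "Q t i \<subseteq> X" for t i
    using P_X by (auto simp: Q_def X_def)
  have Q_ne: "Q t i \<noteq> {}" for t i
    by (auto simp: Q_def N_def)
  have X: "finite X" "X \<noteq> {}"
    by (auto simp: X_def)
  have bdd: "bounded (P t i)" "bounded (Q t i)" for t i
    using P_X Q_X X(1) finite_imp_bounded finite_subset by metis+
  \<comment> \<open>The selected points keep the ball of the whole input, so that ball also covers
    the points dropped by the selection.\<close>
  have Q_sub: "Q t i \<subseteq> MEB (P (Suc t) i)" for t i
    using subset_MEB[OF Q_ne bdd(2)] MEB_P by simp
  have P_sub: "P t j \<subseteq> MEB (P (Suc t) i)" if "j \<in> N t i" for t i j
    using Q_sub[of t i] that by (auto simp: Q_def)
  have self: "i \<in> N t i" for t i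
    by (simp add: N_def)
  \<comment> \<open>With \<open>j = i\<close> this is monotonicity in time; with a neighbor
    \<open>j\<close> it compares radii across an edge.\<close>
  have \<rho>_le: "\<rho> t j \<le> \<rho> (Suc t) i" if "j \<in> N t i" for t i j
    unfolding \<rho>_def by (intro MEB_radius_le_if_subset_MEB P_ne bdd P_sub that)
  have "\<forall>\<^sub>F t in sequentially. \<rho> t i = Max (range (\<lambda>t. \<rho> t i))" for i
  proof (rule incseq_finite_range_eventually_const)
    show "incseq (\<lambda>t. \<rho> t i)"
      by (intro incseq_SucI \<rho>_le self)
    have "range (\<lambda>t. \<rho> t i) \<subseteq> MEB_radius ` Pow X"
      using P_X by (auto simp: \<rho>_def)
    then show "finite (range (\<lambda>t. \<rho> t i))"
      using X(1) finite_subset by blast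
  qed
  \<comment> \<open>There are finitely many agents, so one threshold serves all of them.\<close>
  then have "\<forall>\<^sub>F t in sequentially. \<forall>i. \<rho> t i = Max (range (\<lambda>t. \<rho> t i))"
    by (simp add: eventually_all_finite)
  then obtain T where T: "\<And>t i. t \<ge> T \<Longrightarrow> \<rho> t i = Max (range (\<lambda>t. \<rho> t i))"
    by (auto simp: eventually_sequentially)
  have "MEB (P t i) = MEB X" if "t \<ge> T" for t i
  proof -
    have const: "\<rho> (Suc t) j = \<rho> t j" for j
      using T that by simp
    \<comment> \<open>On an edge \<open>(j, k)\<close>, \<open>\<rho> t k\<close> is at most
      \<open>\<rho> (Suc t) j\<close>, which equals \<open>\<rho> t j\<close>; so radii do not
      increase along edges.\<close>
    have \<rho>_eq: "\<rho> t j = \<rho> t k" for j k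
      by (rule connected_graph_mono_imp_const[OF connectivity[of t]])
        (metis \<rho>_le const N_def neighbors_def UnI1 mem_Collect_eq)
    have MEB_N: "MEB (P t k) = MEB (P (Suc t) j)" if "k \<in> N t j" for j k
      using \<rho>_eq[of j k] const[of j]
      by (intro MEB_eq_if_subset_MEB P_ne bdd P_sub that) (simp add: \<rho>_def)
    have MEB_eq: "MEB (P t j) = MEB (P t k)" for j k
    proof -
      have "(j, k) \<in> (E\<^sub>c\<^sub>m\<^sub>m (p t))\<^sup>*"
        using connectivity by (simp add: connected_graph_def)
      then show ?thesis
      proof induction
        case (step k l)
        then have "l \<in> N t k" by (simp add: N_def neighbors_def)
        \<comment> \<open>Both \<open>k\<close> and \<open>l\<close> lie in \<open>N t k\<close>, so
          both balls at time \<open>t\<close> equal \<open>MEB (P (Suc t) k)\<close>.\<close>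
        then show ?case using step.IH MEB_N self by metis
      qed simp
    qed
    have "p 0 $ j \<in> MEB (P t i)" for j
    proof -
      \<comment> \<open>Agent \<open>j\<close> feeds its stored initial position into every update,
        even if its boundary set no longer contains that point.\<close>
      have "p 0 $ j \<in> MEB (P (Suc t) j)"
        using Q_sub[of t j] self[of j t] by (auto simp: Q_def)
      then show ?thesis using MEB_N[OF self] MEB_eq by metis
    qed
    then have sub: "X \<subseteq> MEB (P t i)" by (auto simp: X_def)
    \<comment> \<open>The reverse comparison: \<open>P t i\<close> consists of initial positions, so
      \<open>MEB X\<close> encloses it.\<close>
    have "MEB_radius (P t i) \<le> MEB_radius X"
      using P_X[of t i] subset_MEB X P_ne
      by (intro MEB_radius_le_if_subset_MEB) (auto simp: finite_imp_bounded)
    then show ?thesis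
      using MEB_eq_if_subset_MEB[OF X(2) P_ne bdd(1) sub] by simp
  qed
  then show ?thesis by (auto simp: P_def X_def)
qed

end
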